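(* Let $q,k\in\mathbb{N}$, let $\mathcal{P}\in\mathfrak{L}^{q+k}$ (plant behavior, with variables partitioned as $(w,c)$, $w\in\mathbb{R}^q$, $c\in\mathbb{R}^k$) and let $\mathcal{R}\in\mathfrak{L}^{q}$ (reference behavior). Let $\mathcal{N}=\{w\in(\mathbb{R}^q)^{\mathbb{N}} : (w,0)\in\mathcal{P}\}$ be the hidden behavior of $\mathcal{P}$. Suppose $L\in\mathbb{N}$ satisfies $L>\max\{\ell(\mathcal{P}),\ell(\mathcal{R}),\ell(\pi_w(\mathcal{P}))\}$. Then $\mathcal{R}$ is implementable if and only if $$\mathcal{N}|_L\subseteq\mathcal{R}|_L\subseteq\pi_w(\mathcal{P})|_L .$$
   Context: $\mathbb{N}$ denotes the positive integers. For $q\in\mathbb{N}$, $(\mathbb{R}^q)^{\mathbb{N}}$ is the set of sequences $w=(w(1),w(2),\dots)$ with $w(t)\in\mathbb{R}^q$, and the shift is $(\sigma w)(t)=w(t+1)$. $\mathfrak{L}^q$ is the set of all $\mathcal{B}\subseteq(\mathbb{R}^q)^{\mathbb{N}}$ that are linear subspaces, shift-invariant ($\sigma\mathcal{B}\subseteq\mathcal{B}$) and complete (closed in the topology of pointwise convergence). Every $\mathcal{B}\in\mathfrak{L}^q$ admits a kernel representation $\mathcal{B}=\ker R(\sigma)=\{w : R(\sigma)w=0\}$ with $R(z)=R_0+R_1z+\dots+R_\ell z^\ell$ a real polynomial matrix with $q$ columns. It is called minimal if its number of rows is as small as possible among kernel representations of $\mathcal{B}$. The lag $\ell(\mathcal{B})$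 is the maximum of the degrees of the rows of $R$ for a minimal kernel representation chosen with smallest possible row degrees (row-reduced), i.e. the smallest value of this maximum over all minimal kernel representations of $\mathcal{B}$ (equal to $0$ if $\mathcal{B}=(\mathbb{R}^q)^{\mathbb{N}}$). For $L\in\mathbb{N}$, $w|_L=(w(1),\dots,w(L))$, identified with a vector in $\mathbb{R}^{qL}$, and $\mathcal{W}|_L=\{w|_L : w\in\mathcal{W}\}$ for a set of sequences $\mathcal{W}$. Elements of $\mathcal{P}\in\mathfrak{L}^{q+k}$ are written as pairs $(w,c)$ with $w\in(\mathbb{R}^q)^{\mathbb{N}}$, $c\in(\mathbb{R}^k)^{\mathbb{N}}$; $\pi_w:(w,c)\mapsto w$ and $\pi_c:(w,c)\mapsto c$ are the projections. The set $\pi_w(\mathcal{P})$ belongs to $\mathfrak{L}^q$, so its lag is defined. For a controller behavior $\mathcal{C}\in\mathfrak{L}^k$, the interconnection of $\mathcal{P}$ and $\mathcal{C}$ via $c$ is $\mathcal{P}\|_c\mathcal{C}=\{(w,c)\in(\mathbb{R}^{q+k})^{\mathbb{N}} : c\in\mathcal{C},\ (w,c)\in\mathcal{P}\}$. A controller $\mathcal{C}\in\mathfrak{L}^k$ implements $\mathcal{R}\in\mathfrak{L}^q$ if $\pi_w(\mathcal{P}\|_c\mathcal{C})=\mathcal{R}$. $\mathcal{R}$ is implementable if there exists $\mathcal{C}\in\mathfrak{L}^k$ which implements $\mathcal{R}$. *)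

theory Defs
  imports "HOL-Analysis.Analysis" "HOL-Computational_Algebra.Polynomial"
begin

text \<open>
  Time series in \<open>\<real>\<^sup>q\<close> are functions \<open>nat \<Rightarrow> real ^ 'n\<close>, where the finite index type \<open>'n\<close> plays
  the role of \<open>{1, \<dots>, q}\<close>. The time axis of positive integers is relabelled to start at \<open>0\<close>:
  \<open>w t\<close> stands for the value at time \<open>t + 1\<close>.
\<close>

definition shift :: "(nat \<Rightarrow> 'a) \<Rightarrow> nat \<Rightarrow> 'a" where
  "shift w = (\<lambda>t. w (Suc t))"

text \<open>
  Linear, shift-invariant, complete behaviors. The topology of the function type
  \<open>nat \<Rightarrow> real ^ 'n\<close> is the product topology, i.e. that of pointwise convergence.
\<close>

definition behavior :: "(nat \<Rightarrow> real ^ 'n) set \<Rightarrow> bool" where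
  "behavior B \<longleftrightarrow>
     (\<lambda>t. 0) \<in> B \<and>
     (\<forall>u\<in>B. \<forall>v\<in>B. (\<lambda>t. u t + v t) \<in> B) \<and>
     (\<forall>a. \<forall>u\<in>B. (\<lambda>t. a *\<^sub>R u t) \<in> B) \<and>
     shift ` B \<subseteq> B \<and>
     closed B"

text \<open>
  A real polynomial matrix is given by the list of its rows, so its number of rows (possibly \<open>0\<close>)
  is the length of the list.
\<close>

definition row_op :: "(real poly) ^ 'n \<Rightarrow> (nat \<Rightarrow> real ^ 'n) \<Rightarrow> nat \<Rightarrow> real" where
  "row_op r w = (\<lambda>t. \<Sum>j\<in>UNIV. \<Sum>i\<le>degree (r $ j). coeff (r $ j) i * ((shift ^^ i) w t $ j))"

definition ker :: "((real poly) ^ 'n) list \<Rightarrow> (nat \<Rightarrow> real ^ 'n) set" where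
  "ker R = {w. \<forall>r\<in>set R. row_op r w = (\<lambda>t. 0)}"

definition minimal_kernel_rep :: "((real poly) ^ 'n) list \<Rightarrow> (nat \<Rightarrow> real ^ 'n) set \<Rightarrow> bool" where
  "minimal_kernel_rep R B \<longleftrightarrow> B = ker R \<and> (\<forall>S. B = ker S \<longrightarrow> length R \<le> length S)"

definition row_degree :: "(real poly) ^ 'n \<Rightarrow> nat" where
  "row_degree r = Max (range (\<lambda>j. degree (r $ j)))"

text \<open>
  The \<open>0\<close> only matters for the matrix without rows, which represents the full space.
  (A zero row has \<open>row_degree\<close> \<open>0\<close>, but it never occurs in a minimal representation.)
\<close>

definition max_row_degree :: "((real poly) ^ 'n) list \<Rightarrow> nat" where
  "max_row_degree R = Max (insert 0 (row_degree ` set R))"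

definition lag :: "(nat \<Rightarrow> real ^ 'n) set \<Rightarrow> nat" where
  "lag B = (LEAST d. \<exists>R. minimal_kernel_rep R B \<and> max_row_degree R = d)"

text \<open>The tuple \<open>(w(1), \<dots>, w(L))\<close>, as a list of length \<open>L\<close>.\<close>

definition window :: "nat \<Rightarrow> (nat \<Rightarrow> 'a) \<Rightarrow> 'a list" where
  "window L w = map w [0..<L]"

text \<open>
  Variables partitioned as \<open>(w, c)\<close>: \<open>\<real>\<^bsup>q+k\<^esup>\<close> is indexed by the sum type \<open>'q + 'k\<close>.
\<close>

definition join ::
  "(nat \<Rightarrow> real ^ 'q) \<Rightarrow> (nat \<Rightarrow> real ^ 'k) \<Rightarrow> nat \<Rightarrow> real ^ ('q::finite + 'k::finite)" where
  "join w c = (\<lambda>t. \<chi> i. case i of Inl j \<Rightarrow> w t $ j | Inr j \<Rightarrow> c t $ j)"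

definition proj_w :: "(nat \<Rightarrow> real ^ ('q::finite + 'k::finite)) \<Rightarrow> nat \<Rightarrow> real ^ 'q" where
  "proj_w x = (\<lambda>t. \<chi> j. x t $ Inl j)"

definition proj_c :: "(nat \<Rightarrow> real ^ ('q::finite + 'k::finite)) \<Rightarrow> nat \<Rightarrow> real ^ 'k" where
  "proj_c x = (\<lambda>t. \<chi> j. x t $ Inr j)"

definition interconnection ::
  "(nat \<Rightarrow> real ^ ('q::finite + 'k::finite)) set \<Rightarrow> (nat \<Rightarrow> real ^ 'k) set \<Rightarrow> (nat \<Rightarrow> real ^ ('q + 'k)) set" where
  "interconnection P C = {join w c | w c. c \<in> C \<and> join w c \<in> P}"

definition implements ::
  "(nat \<Rightarrow> real ^ ('q::finite + 'k::finite)) set \<Rightarrow> (nat \<Rightarrow> real ^ 'k) set \<Rightarrow> (nat \<Rightarrow> real ^ 'q) set \<Rightarrow> bool" where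
  "implements P C R \<longleftrightarrow> proj_w ` interconnection P C = R"

definition implementable ::
  "(nat \<Rightarrow> real ^ ('q::finite + 'k::finite)) set \<Rightarrow> (nat \<Rightarrow> real ^ 'q) set \<Rightarrow> bool" where
  "implementable P R \<longleftrightarrow> (\<exists>C. behavior C \<and> implements P C R)"

definition hidden_behavior ::
  "(nat \<Rightarrow> real ^ ('q::finite + 'k::finite)) set \<Rightarrow> (nat \<Rightarrow> real ^ 'q) set" where
  "hidden_behavior P = {w. join w (\<lambda>t. 0) \<in> P}"

lemma shift_funpow: "(shift ^^ i) w t = w (t + i)"
  by (induction i arbitrary: t) (simp_all add: shift_def)

lemma proj_w_join [simp]: "proj_w (join w c) = w"
  by (simp add: proj_w_def join_def)

lemma proj_c_join [simp]: "proj_c (join w c) = c"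
  by (simp add: proj_c_def join_def)

lemma join_proj [simp]: "join (proj_w x) (proj_c x) = x"
  by (auto simp: fun_eq_iff vec_eq_iff proj_w_def proj_c_def join_def split: sum.split)

end

theory Submission
  imports Defs
begin

text \<open>
  The window condition is a finite form of the chain of inclusions
  \<open>hidden_behavior P \<subseteq> R \<subseteq> proj_w ` P\<close>. A kernel representation whose rows have degree less than
  \<open>L\<close> tests a trajectory through \<open>L\<close> consecutive values at a time, so a shift-invariant set all of
  whose windows of length \<open>L\<close> occur in a behavior of lag less than \<open>L\<close> lies in that behavior
  (\<open>subset_if_windows_subset\<close>).

  The chain itself characterizes implementability. If a controller implements \<open>R\<close>, then it admits
  \<open>c = 0\<close>, which lets every hidden trajectory through, and \<open>R\<close> consists of \<open>w\<close>-parts of plant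
  trajectories. Conversely, take as controller all \<open>c\<close> that occur in the plant together with some
  \<open>w\<close> in \<open>R\<close>. It admits all of \<open>R\<close>; and if it admits a pair \<open>(w, c)\<close>, then \<open>c\<close> also occurs with
  some \<open>w'\<close> in \<open>R\<close>, so \<open>w - w'\<close> is hidden, hence in \<open>R\<close>, hence so is \<open>w\<close>.

  The work lies in the two facts that make this argument meaningful, and both come from finite
  dimension. A behavior has a kernel representation with finitely many rows, because it is
  determined by its windows of some fixed length (\<open>behavior_finite_memory\<close>) and a linear space of
  windows is cut out by finitely many equations (\<open>window_equations\<close>); this is what gives the lag
  its meaning. And the projection of a behavior is again a behavior (\<open>behavior_image\<close>), although
  continuous images of closed sets are in general not closed: descending chains of closed affine
  sets of sequences have nonempty intersection (\<open>affine_chain_Inter\<close>), which plays the role of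
  compactness. Both rest on the stabilization of descending chains of affine subspaces of a
  Euclidean space.
\<close>

section \<open>Windows\<close>

lemma window_eq_iff: "window L u = window L v \<longleftrightarrow> (\<forall>t<L. u t = v t)"
  by (auto simp: window_def)

lemma window_mem_iff: "window L w \<in> window L ` B \<longleftrightarrow> (\<exists>v\<in>B. \<forall>t<L. v t = w t)"
  by (auto simp: image_iff window_eq_iff eq_commute)

text \<open>
  In the topology of pointwise convergence, sequences that agree with \<open>w\<close> on longer and longer
  windows converge to \<open>w\<close>.
\<close>

lemma closed_windows_imp_mem:
  fixes B :: "(nat \<Rightarrow> 'a::topological_space) set"
  assumes "closed B" and w: "\<And>L. window L w \<in> window L ` B"
  shows "w \<in> B"
proof -
  have "\<forall>L. \<exists>v\<in>B. \<forall>t<L. v t = w t"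
    using w by (simp add: window_mem_iff)
  then obtain v where v: "\<And>L. v L \<in> B" "\<And>L t. t < L \<Longrightarrow> v L t = w t"
    by metis
  have "(\<lambda>L. v L t) \<longlonglongrightarrow> w t" for t
    by (rule tendsto_eventually)
       (use v(2) in \<open>auto simp: eventually_sequentially intro!: exI[of _ "Suc t"]\<close>)
  then have "v \<longlonglongrightarrow> w"
    using limitin_componentwise[of "\<lambda>_. euclidean" UNIV v w sequentially]
    by (simp add: euclidean_product_topology)
  then show ?thesis
    by (rule Lim_in_closed_set[OF assms(1) _ sequentially_bot, rotated]) (simp add: v(1))
qed

section \<open>Finitely many linear equations cut out the windows of a linear set\<close>

text \<open>
  This is Gaussian elimination, one coordinate \<open>j\<close> at a time. If some \<open>s0\<close> in \<open>S\<close> does not vanish at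
  \<open>j\<close>, subtracting a multiple of \<open>s0\<close> makes the coordinate \<open>j\<close> zero without affecting membership,
  and the equations found for the remaining coordinates extend uniquely to ones that hold for
  \<open>s0\<close>. Otherwise the vanishing of the coordinate \<open>j\<close> is itself one of the
  equations, and the others do not involve \<open>j\<close>.
\<close>

lemma finite_equations:
  fixes S :: "('i \<Rightarrow> real) set"
  assumes "finite I" and "S \<noteq> {}"
    and "\<And>a f g. f \<in> S \<Longrightarrow> g \<in> S \<Longrightarrow> (\<lambda>i. a * f i + g i) \<in> S"
  shows "\<exists>C. finite C \<and>
    (\<forall>u. (\<exists>s\<in>S. \<forall>i\<in>I. s i = u i) \<longleftrightarrow> (\<forall>c\<in>C. (\<Sum>i\<in>I. c i * u i) = 0))"
  using assms
proof (induction I arbitrary: S rule: finite_induct)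
  case empty
  then show ?case by (intro exI[of _ "{}"]) auto
next
  case (insert j I)
  note lin = insert.prems(2)
  show ?case
  proof (cases "\<exists>s\<in>S. s j \<noteq> 0")
    case True
    then obtain s0 where s0: "s0 \<in> S" "s0 j \<noteq> 0" by blast
    define S' where "S' = {s \<in> S. s j = 0}"
    define elim where "elim u = (\<lambda>i. (- (u j / s0 j)) * s0 i + u i)" for u
    define lift where "lift c = c(j := - ((\<Sum>i\<in>I. c i * s0 i) / s0 j))" for c
    have "elim s0 \<in> S'"
      using s0 lin[OF s0(1) s0(1), of "-1"] by (simp add: S'_def elim_def)
    then have "S' \<noteq> {}" by blast
    moreover have "(\<lambda>i. a * f i + g i) \<in> S'" if "f \<in> S'" "g \<in> S'" for a f g
      using that lin by (auto simp: S'_def)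
    ultimately obtain C where C: "finite C"
      "\<And>u. (\<exists>s\<in>S'. \<forall>i\<in>I. s i = u i) \<longleftrightarrow> (\<forall>c\<in>C. (\<Sum>i\<in>I. c i * u i) = 0)"
      using insert.IH[of S'] by blast
    have "(\<exists>s\<in>S. \<forall>i\<in>insert j I. s i = u i) \<longleftrightarrow> (\<exists>s\<in>S'. \<forall>i\<in>I. s i = elim u i)" for u
    proof
      assume "\<exists>s\<in>S. \<forall>i\<in>insert j I. s i = u i"
      then obtain s where s: "s \<in> S" "\<forall>i\<in>insert j I. s i = u i" by blast
      have "elim s \<in> S'"
        using s0 lin[OF s0(1) s(1), of "- (s j / s0 j)"] by (simp add: S'_def elim_def)
      moreover have "\<forall>i\<in>I. elim s i = elim u i"
        using s(2) by (simp add: elim_def)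
      ultimately show "\<exists>s\<in>S'. \<forall>i\<in>I. s i = elim u i" by blast
    next
      assume "\<exists>s\<in>S'. \<forall>i\<in>I. s i = elim u i"
      then obtain s where s: "s \<in> S" "s j = 0" "\<forall>i\<in>I. s i = elim u i"
        by (auto simp: S'_def)
      show "\<exists>s\<in>S. \<forall>i\<in>insert j I. s i = u i"
        using lin[OF s0(1) s(1), of "u j / s0 j"] s s0(2)
        by (intro bexI[of _ "\<lambda>i. (u j / s0 j) * s0 i + s i"]) (auto simp: elim_def)
    qed
    moreover have "(\<Sum>i\<in>I. c i * elim u i) = (\<Sum>i\<in>insert j I. lift c i * u i)" for c u
    proof -
      have "(\<Sum>i\<in>insert j I. lift c i * u i) =
          lift c j * u j + (\<Sum>i\<in>I. c i * u i)"
        using insert.hyps by (auto simp: lift_def intro!: sum.cong)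
      also have "(\<Sum>i\<in>I. c i * elim u i) =
          - (u j / s0 j) * (\<Sum>i\<in>I. c i * s0 i) + (\<Sum>i\<in>I. c i * u i)"
        by (simp add: elim_def sum_distrib_left sum.distrib[symmetric] algebra_simps)
      ultimately show ?thesis by (simp add: lift_def)
    qed
    ultimately show ?thesis
      using C by (intro exI[of _ "lift ` C"]) auto
  next
    case False
    obtain C where C: "finite C"
      "\<And>u. (\<exists>s\<in>S. \<forall>i\<in>I. s i = u i) \<longleftrightarrow> (\<forall>c\<in>C. (\<Sum>i\<in>I. c i * u i) = 0)"
      using insert.IH[OF insert.prems] by blast
    define ej where "ej = (\<lambda>i. if i = j then 1 else 0 :: real)"
    have ej: "(\<Sum>i\<in>insert j I. ej i * u i) = u j" for u :: "'i \<Rightarrow> real"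
      using insert.hyps by (simp add: ej_def if_distrib[of "\<lambda>x. x * _"] cong: if_cong)
    define drop_j where "drop_j c = c(j := 0)" for c :: "'i \<Rightarrow> real"
    have ext: "(\<Sum>i\<in>insert j I. drop_j c i * u i) = (\<Sum>i\<in>I. c i * u i)" for c u :: "'i \<Rightarrow> real"
      using insert.hyps by (auto simp: drop_j_def intro!: sum.cong)
    have "(\<exists>s\<in>S. \<forall>i\<in>insert j I. s i = u i) \<longleftrightarrow> u j = 0 \<and> (\<exists>s\<in>S. \<forall>i\<in>I. s i = u i)" for u
      using False by auto metis
    then show ?thesis
      using C by (intro exI[of _ "insert ej (drop_j ` C)"]) (simp add: ej ext del: sum.insert)
  qed
qed

lemma window_equations:
  fixes B :: "(nat \<Rightarrow> real ^ 'n) set"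
  assumes "B \<noteq> {}"
    and lin: "\<And>a u v. u \<in> B \<Longrightarrow> v \<in> B \<Longrightarrow> (\<lambda>t. a *\<^sub>R u t + v t) \<in> B"
  shows "\<exists>C :: (nat \<Rightarrow> real ^ 'n) set. finite C \<and>
    (\<forall>w. window L w \<in> window L ` B \<longleftrightarrow> (\<forall>c\<in>C. (\<Sum>t<L. c t \<bullet> w t) = 0))"
proof -
  define entries where "entries w = (\<lambda>(t, j). w t $ j)" for w :: "nat \<Rightarrow> real ^ 'n"
  define I where "I = {..<L} \<times> (UNIV :: 'n set)"
  have "(\<lambda>i. a * f i + g i) \<in> entries ` B" if fg: "f \<in> entries ` B" "g \<in> entries ` B" for a f g
  proof -
    obtain u v where "u \<in> B" "v \<in> B" "f = entries u" "g = entries v"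
      using fg by blast
    then show ?thesis
      by (intro image_eqI[OF _ lin[of u v a]]) (auto simp: entries_def)
  qed
  then obtain C where C: "finite C"
    "\<And>u. (\<exists>s\<in>entries ` B. \<forall>i\<in>I. s i = u i) \<longleftrightarrow> (\<forall>c\<in>C. (\<Sum>i\<in>I. c i * u i) = 0)"
    using finite_equations[of I "entries ` B"] assms(1) by (auto simp: I_def)
  define vec where "vec c = (\<lambda>t. \<chi> j. c (t, j))" for c :: "nat \<times> 'n \<Rightarrow> real"
  have "(\<exists>s\<in>entries ` B. \<forall>i\<in>I. s i = entries w i) \<longleftrightarrow> window L w \<in> window L ` B" for w
    by (auto simp: I_def entries_def window_mem_iff vec_eq_iff)
  moreover have "(\<Sum>i\<in>I. c i * entries w i) = (\<Sum>t<L. vec c t \<bullet> w t)" for c w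
    by (simp add: I_def entries_def vec_def inner_vec_def sum.cartesian_product split_beta)
  ultimately show ?thesis
    using C by (intro exI[of _ "vec ` C"]) auto
qed

text \<open>
  Each window space is finite-dimensional, hence closed, so limits bring no new windows: the
  equations of \<open>window_equations\<close> are continuous in \<open>w\<close> and survive passing to the closure.
\<close>

lemma closure_windows:
  fixes B :: "(nat \<Rightarrow> real ^ 'n) set"
  assumes "B \<noteq> {}"
    and "\<And>a u v. u \<in> B \<Longrightarrow> v \<in> B \<Longrightarrow> (\<lambda>t. a *\<^sub>R u t + v t) \<in> B"
    and "w \<in> closure B"
  shows "window L w \<in> window L ` B"
proof -
  obtain C where C: "finite C"
    "\<And>w. window L w \<in> window L ` B \<longleftrightarrow> (\<forall>c\<in>C. (\<Sum>t<L. c t \<bullet> w t) = 0)"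
    using window_equations[OF assms(1,2), of L] by blast
  have "{w. window L w \<in> window L ` B} = (\<Inter>c\<in>C. {w. (\<Sum>t<L. c t \<bullet> w t) = 0})"
    by (auto simp: C(2))
  also have "closed \<dots>"
    by (intro closed_INT ballI closed_Collect_eq continuous_intros)
      (auto intro: continuous_on_product_coordinates)
  finally have "closure B \<subseteq> {w. window L w \<in> window L ` B}"
    by (intro closure_minimal) auto
  then show ?thesis using assms(3) by blast
qed

section \<open>Descending chains of affine sets\<close>

lemma affine_chain_stabilizes:
  fixes A :: "nat \<Rightarrow> 'a::euclidean_space set"
  assumes "\<And>n. affine (A n)" and "\<And>n. A n \<noteq> {}" and "\<And>n. A (Suc n) \<subseteq> A n"
  obtains N where "\<And>n. n \<ge> N \<Longrightarrow> A n = A N"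
proof -
  obtain N where N: "\<And>n. nat (aff_dim (A N)) \<le> nat (aff_dim (A n))"
    using ex_has_least_nat[of "\<lambda>_. True" _ "\<lambda>n. nat (aff_dim (A n))"] by auto
  show ?thesis
  proof (rule that)
    fix n assume "n \<ge> N"
    then have sub: "A n \<subseteq> A N"
      by (rule lift_Suc_antimono_le[of A, OF assms(3)])
    have "\<not> aff_dim (A n) < 0" and "aff_dim (A n) \<le> aff_dim (A N)"
      using assms(2) aff_dim_subset[OF sub] by simp_all
    then have "aff_dim (A n) = aff_dim (A N)"
      using N[of n] by linarith
    then show "A n = A N"
      using affine_dim_equal assms(1,2) sub by metis
  qed
qed

text \<open>
  A common point is built value by value. A prefix \<open>d\<close> of length \<open>M\<close> is good if it is the
  beginning of a member of every \<open>V T\<close>. For a good prefix the possible next values form a descending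
  chain of nonempty affine sets \<open>A T\<close>; the chain stabilizes, so one next value serves all \<open>T\<close> and
  the prefix extends to a good one of length \<open>M + 1\<close>.
\<close>

lemma affine_chain_Inter:
  fixes V :: "nat \<Rightarrow> (nat \<Rightarrow> 'a::euclidean_space) set"
  assumes "\<And>T. closed (V T)" and ne: "\<And>T. V T \<noteq> {}" and dec: "\<And>T. V (Suc T) \<subseteq> V T"
    and aff: "\<And>T a b x y. x \<in> V T \<Longrightarrow> y \<in> V T \<Longrightarrow> a + b = 1 \<Longrightarrow>
      (\<lambda>t. a *\<^sub>R x t + b *\<^sub>R y t) \<in> V T"
  shows "(\<Inter>T. V T) \<noteq> {}"
proof -
  define good where "good M d \<longleftrightarrow> (\<forall>T. window M d \<in> window M ` V T)" for M and d :: "nat \<Rightarrow> 'a"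
  have "good 0 d" for d
    using ne by (auto simp: good_def window_def)
  moreover have "\<exists>e. good (Suc M) e \<and> window M e = window M d" if d: "good M d" for M d
  proof -
    define A where "A T = {x M | x. x \<in> V T \<and> (\<forall>t<M. x t = d t)}" for T
    have "A T \<noteq> {}" for T
      using d by (fastforce simp: A_def good_def window_mem_iff)
    moreover have "A (Suc T) \<subseteq> A T" for T
      using dec by (auto simp: A_def)
    moreover have "affine (A T)" for T
      unfolding affine_def
    proof (intro ballI allI impI)
      fix p r and a b :: real
      assume "p \<in> A T" "r \<in> A T" and ab: "a + b = 1"
      then obtain x y where "x \<in> V T" "\<forall>t<M. x t = d t" "x M = p"
        "y \<in> V T" "\<forall>t<M. y t = d t" "y M = r"
        by (auto simp: A_def)
      then show "a *\<^sub>R p + b *\<^sub>R r \<in> A T"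
        using aff[of x T y a b] ab by (auto simp: A_def scaleR_left_distrib[symmetric]
          intro!: exI[of _ "\<lambda>t. a *\<^sub>R x t + b *\<^sub>R y t"])
    qed
    ultimately obtain N where N: "\<And>T. T \<ge> N \<Longrightarrow> A T = A N" and "A N \<noteq> {}"
      using affine_chain_stabilizes[of A] by metis
    then obtain p where p: "p \<in> A N" by blast
    have "p \<in> A T" for T
    proof (cases "N \<le> T")
      case False
      then have "A N \<subseteq> A T"
        using lift_Suc_antimono_le[of A] \<open>\<And>T. A (Suc T) \<subseteq> A T\<close> by simp
      then show ?thesis using p by blast
    qed (use N[of T] p in simp)
    have "window (Suc M) (d(M := p)) \<in> window (Suc M) ` V T" for T
    proof -
      obtain x where "x \<in> V T" "\<forall>t<M. x t = d t" "x M = p"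
        using \<open>\<And>T. p \<in> A T\<close>[of T] by (auto simp: A_def)
      then show ?thesis
        by (auto simp: window_mem_iff less_Suc_eq intro!: bexI[of _ x])
    qed
    then have "good (Suc M) (d(M := p))"
      by (simp add: good_def)
    then show ?thesis
      by (intro exI[of _ "d(M := p)"]) (auto simp: window_eq_iff)
  qed
  ultimately obtain d where d: "\<And>M. good M (d M)" "\<And>M. window M (d (Suc M)) = window M (d M)"
    using dependent_nat_choice[of good "\<lambda>M d e. window M e = window M d"] by metis
  define l where "l t = d (Suc t) t" for t
  have "d M t = l t" if "t < M" for t M
    using that
  proof (induction M)
    case (Suc M)
    then show ?case
      using d(2)[of M] by (cases "t = M") (auto simp: l_def window_eq_iff)
  qed simp
  then have "window M l = window M (d M)" for M
    by (simp add: window_eq_iff)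
  then have "window M l \<in> window M ` V T" for M T
    using d(1)[of M] by (simp add: good_def)
  then have "l \<in> V T" for T
    by (rule closed_windows_imp_mem[OF assms(1)])
  then have "l \<in> (\<Inter>T. V T)"
    by (rule INT_I)
  then show ?thesis
    by auto
qed

section \<open>Behaviors: images and kernel representations\<close>

lemma behavior_ne: "behavior B \<Longrightarrow> B \<noteq> {}"
  by (auto simp: behavior_def)

lemma behavior_lincomb:
  assumes B: "behavior B" and uv: "u \<in> B" "v \<in> B"
  shows "(\<lambda>t. a *\<^sub>R u t + b *\<^sub>R v t) \<in> B"
proof -
  have "\<forall>a. \<forall>u\<in>B. (\<lambda>t. a *\<^sub>R u t) \<in> B"
    using B unfolding behavior_def by (elim conjE)
  then have "(\<lambda>t. a *\<^sub>R u t) \<in> B" "(\<lambda>t. b *\<^sub>R v t) \<in> B"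
    using uv by fast+
  moreover have "\<forall>u\<in>B. \<forall>v\<in>B. (\<lambda>t. u t + v t) \<in> B"
    using B unfolding behavior_def by (elim conjE)
  ultimately show ?thesis
    by fast
qed

lemma behavior_diff: "behavior B \<Longrightarrow> u \<in> B \<Longrightarrow> v \<in> B \<Longrightarrow> (\<lambda>t. u t - v t) \<in> B"
  using behavior_lincomb[of B u v 1 "-1"] by simp

lemma shift_invariant_tail: "shift ` A \<subseteq> A \<Longrightarrow> w \<in> A \<Longrightarrow> (\<lambda>s. w (t + s)) \<in> A"
proof (induction t)
  case (Suc t)
  then have "shift (\<lambda>s. w (t + s)) \<in> A" by blast
  then show ?case by (simp add: shift_def)
qed simp

lemma continuous_on_pointwise:
  fixes f :: "real ^ 'a \<Rightarrow> real ^ 'b"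
  assumes "linear f"
  shows "continuous_on S (\<lambda>x t. f (x t))"
proof (rule continuous_on_coordinatewise_then_product)
  fix t
  show "continuous_on S (\<lambda>x. f (x t))"
  proof (rule continuous_on_compose2[where g = f and f = "\<lambda>x. x t" and t = UNIV])
    show "continuous_on UNIV f"
      using assms by (simp add: linear_continuous_on linear_conv_bounded_linear)
    show "continuous_on S (\<lambda>x. x t)"
      by (rule continuous_on_subset[OF continuous_on_product_coordinates]) simp
  qed simp
qed

text \<open>
  For \<open>w\<close> in the closure of the image, the set \<open>V T\<close> of those \<open>x\<close> in \<open>P\<close> whose image agrees with
  \<open>w\<close> on the first \<open>T\<close> values is closed, affine and nonempty, and it shrinks with \<open>T\<close>. A common
  member of all of them is a preimage of \<open>w\<close>.
\<close>

lemma behavior_image: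
  fixes f :: "real ^ 'a \<Rightarrow> real ^ 'b"
  assumes P: "behavior P" and f: "linear f"
  shows "behavior ((\<lambda>x t. f (x t)) ` P)" (is "behavior (?F ` P)")
proof -
  interpret linear f by fact
  have lin: "(\<lambda>t. a *\<^sub>R u t + b *\<^sub>R v t) \<in> ?F ` P" if uv: "u \<in> ?F ` P" "v \<in> ?F ` P" for a b u v
  proof -
    obtain x y where "x \<in> P" "y \<in> P" "u = ?F x" "v = ?F y"
      using uv by blast
    then show ?thesis
      using behavior_lincomb[OF P, of x y a b]
      by (intro image_eqI[of _ _ "\<lambda>t. a *\<^sub>R x t + b *\<^sub>R y t"]) (auto simp: add scale)
  qed
  have ne: "?F ` P \<noteq> {}"
    using behavior_ne[OF P] by blast
  have "w \<in> ?F ` P" if w: "w \<in> closure (?F ` P)" for w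
  proof -
    define V where "V T = {x \<in> P. \<forall>t<T. f (x t) = w t}" for T
    have V_eq: "V T = P \<inter> (\<Inter>t<T. {x. ?F x t = w t})" for T
      by (auto simp: V_def)
    have "(\<Inter>T. V T) \<noteq> {}"
    proof (rule affine_chain_Inter)
      show "closed (V T)" for T
        unfolding V_eq using P
        by (intro closed_Int closed_INT ballI closed_Collect_eq continuous_on_const
            continuous_on_product_then_coordinatewise[OF continuous_on_pointwise[OF f]])
          (simp add: behavior_def)
      show "V T \<noteq> {}" for T
        using closure_windows[OF ne _ w, of T] lin[of _ _ _ 1]
        by (auto simp: window_mem_iff V_def)
      show "V (Suc T) \<subseteq> V T" for T
        by (auto simp: V_def)
      show "(\<lambda>t. a *\<^sub>R x t + b *\<^sub>R y t) \<in> V T"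
        if "x \<in> V T" "y \<in> V T" "a + b = 1" for T a b x y
        using that behavior_lincomb[OF P, of x y a b]
        by (auto simp: V_def add scale scaleR_left_distrib[symmetric])
    qed
    then obtain x where x: "\<And>T. x \<in> V T" by blast
    then have "x \<in> P" "?F x = w"
      by (auto simp: V_def fun_eq_iff)
    then show ?thesis by blast
  qed
  then have "closed (?F ` P)"
    by (metis closure_subset closed_closure subset_antisym subsetI)
  moreover have "shift (?F x) \<in> ?F ` P" if "x \<in> P" for x
    using that P by (intro image_eqI[of _ _ "shift x"]) (auto simp: shift_def behavior_def)
  moreover have "(\<lambda>t. 0) \<in> ?F ` P"
    using lin[of _ _ 0 0] ne by auto
  moreover have "(\<lambda>t. u t + v t) \<in> ?F ` P" if "u \<in> ?F ` P" "v \<in> ?F ` P" for u v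
    using lin[OF that, of 1 1] by simp
  moreover have "(\<lambda>t. a *\<^sub>R u t) \<in> ?F ` P" if "u \<in> ?F ` P" for a u
    using lin[OF that that, of a 0] by simp
  ultimately show ?thesis
    unfolding behavior_def by blast
qed

text \<open>
  \<open>K M\<close> holds the values that can follow \<open>M\<close> zeros in \<open>B\<close>: it measures the freedom in the next value
  once a prefix of length \<open>M\<close> is given. Shift-invariance makes it a descending chain of subspaces,
  so from some \<open>N\<close> on a longer past gives no more information about the next value. Hence a
  sequence whose windows of length \<open>N + 1\<close> are all in \<open>B\<close> has all longer windows in \<open>B\<close> as well.
\<close>

lemma behavior_finite_memory:
  fixes B :: "(nat \<Rightarrow> real ^ 'n) set"
  assumes B: "behavior B"
  obtains L where "\<And>w. (\<And>t. window L (\<lambda>s. w (t + s)) \<in> window L ` B) \<Longrightarrow> w \<in> B"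
proof -
  define K where "K M = {v M | v. v \<in> B \<and> (\<forall>t<M. v t = 0)}" for M
  have "affine (K M)" for M
    unfolding affine_def
  proof (intro ballI allI impI)
    fix p r and a b :: real
    assume "p \<in> K M" "r \<in> K M"
    then obtain x y where "x \<in> B" "\<forall>t<M. x t = 0" "x M = p" "y \<in> B" "\<forall>t<M. y t = 0" "y M = r"
      by (auto simp: K_def)
    then show "a *\<^sub>R p + b *\<^sub>R r \<in> K M"
      using behavior_lincomb[OF B, of x y a b]
      by (auto simp: K_def intro!: exI[of _ "\<lambda>t. a *\<^sub>R x t + b *\<^sub>R y t"])
  qed
  moreover have "0 \<in> K M" for M
    using B by (auto simp: K_def behavior_def intro!: exI[of _ "\<lambda>t. 0"])
  then have "K M \<noteq> {}" for M by blast
  moreover have "K (Suc M) \<subseteq> K M" for M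
  proof
    fix p assume "p \<in> K (Suc M)"
    then obtain v where "v \<in> B" "\<forall>t<Suc M. v t = 0" "v (Suc M) = p"
      by (auto simp: K_def)
    then show "p \<in> K M"
      using B by (auto simp: K_def behavior_def shift_def intro!: exI[of _ "shift v"])
  qed
  ultimately obtain N where N: "\<And>M. M \<ge> N \<Longrightarrow> K M = K N"
    using affine_chain_stabilizes[of K] by metis
  show ?thesis
  proof (rule that[of "Suc N"])
    fix w
    assume w: "\<And>t. window (Suc N) (\<lambda>s. w (t + s)) \<in> window (Suc N) ` B"
    have step: "window (Suc N + m) (\<lambda>s. w (t + s)) \<in> window (Suc N + m) ` B" for m t
    proof (induction m arbitrary: t)
      case 0
      then show ?case using w by simp
    next
      case (Suc m)
      define M where "M = N + m"
      obtain v where v: "v \<in> B" "\<forall>s\<le>M. v s = w (t + s)"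
        using Suc.IH[of t] by (auto simp: window_mem_iff M_def less_Suc_eq_le)
      obtain u where u: "u \<in> B" "\<forall>s\<le>M. u s = w (Suc t + s)"
        using Suc.IH[of "Suc t"] by (auto simp: window_mem_iff M_def less_Suc_eq_le)
      \<comment> \<open>\<open>v\<close> continues the first \<open>M + 1\<close> values with a possibly wrong next one; the window one step
        later, matched by \<open>u\<close>, shows that the error lies in \<open>K M = K (Suc M)\<close> and can be corrected
        by some \<open>y\<close> that leaves the earlier values alone.\<close>
      have "shift v \<in> B"
        using v(1) B by (auto simp: behavior_def)
      then have "(\<lambda>s. shift v s - u s) \<in> B"
        using behavior_diff[OF B] u(1) by blast
      then have "v (Suc M) - w (t + Suc M) \<in> K M"
        using v(2) u(2) by (auto simp: K_def shift_def intro!: exI[of _ "\<lambda>s. shift v s - u s"])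
      then have "v (Suc M) - w (t + Suc M) \<in> K (Suc M)"
        using N[of M] N[of "Suc M"] by (simp add: M_def)
      then obtain y where y: "y \<in> B" "\<forall>s\<le>M. y s = 0" "y (Suc M) = v (Suc M) - w (t + Suc M)"
        by (auto simp: K_def less_Suc_eq_le)
      have "(\<lambda>s. v s - y s) \<in> B"
        using behavior_diff[OF B] v(1) y(1) by blast
      moreover have "v s - y s = w (t + s)" if "s < Suc N + Suc m" for s
        using that v(2) y(2,3) by (cases "s = Suc M") (auto simp: M_def)
      ultimately show ?case
        unfolding window_mem_iff by (intro bexI[of _ "\<lambda>s. v s - y s"]) auto
    qed
    have "window M w \<in> window M ` B" for M
    proof -
      have "\<exists>v\<in>B. \<forall>s<Suc N + M. v s = w s"
        using step[of M 0] by (simp add: window_mem_iff)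
      then obtain v where "v \<in> B" "\<forall>s<Suc N + M. v s = w s" ..
      then show ?thesis
        unfolding window_mem_iff by (intro bexI[of _ v]) auto
    qed
    then show "w \<in> B"
      using closed_windows_imp_mem[of B w] B by (simp add: behavior_def)
  qed
qed

lemma row_op_eq: "row_op r w t = (\<Sum>j\<in>UNIV. \<Sum>i\<le>degree (r $ j). coeff (r $ j) i * (w (t + i) $ j))"
  by (simp add: row_op_def shift_funpow)

lemma behavior_kernel_rep:
  fixes B :: "(nat \<Rightarrow> real ^ 'n) set"
  assumes B: "behavior B"
  obtains R where "B = ker R"
proof -
  obtain L where L: "\<And>w. (\<And>t. window L (\<lambda>s. w (t + s)) \<in> window L ` B) \<Longrightarrow> w \<in> B"
    using behavior_finite_memory[OF B] by blast
  have lin: "(\<lambda>t. a *\<^sub>R u t + v t) \<in> B" if "u \<in> B" "v \<in> B" for a u v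
    using behavior_lincomb[OF B that, of a 1] by simp
  obtain C where C: "finite C"
    "\<And>w. window L w \<in> window L ` B \<longleftrightarrow> (\<forall>c\<in>C. (\<Sum>t<L. c t \<bullet> w t) = 0)"
    using window_equations[OF behavior_ne[OF B] lin, of L] by blast
  \<comment> \<open>An equation \<open>c\<close> on windows of length \<open>L\<close> turns into a polynomial row, whose action at
    time \<open>t\<close> is the equation for the window that starts at \<open>t\<close>.\<close>
  define row where "row c = (\<chi> j. \<Sum>i<L. monom (c i $ j) i)" for c :: "nat \<Rightarrow> real ^ 'n"
  have row: "row_op (row c) w t = (\<Sum>s<L. c s \<bullet> w (t + s))" for c w t
  proof -
    have cf: "coeff (row c $ j) i = (if i < L then c i $ j else 0)" for i j
      by (simp add: row_def coeff_sum)
    have "(\<Sum>i\<le>degree (row c $ j). coeff (row c $ j) i * (w (t + i) $ j)) =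
        (\<Sum>i<L. c i $ j * (w (t + i) $ j))" for j
    proof -
      have "(\<Sum>i\<le>degree (row c $ j). coeff (row c $ j) i * (w (t + i) $ j)) =
          (\<Sum>i<L + Suc (degree (row c $ j)). coeff (row c $ j) i * (w (t + i) $ j))"
        by (rule sum.mono_neutral_left) (auto simp: coeff_eq_0)
      also have "\<dots> = (\<Sum>i<L. coeff (row c $ j) i * (w (t + i) $ j))"
        by (rule sum.mono_neutral_right) (auto simp: cf)
      finally show ?thesis by (simp add: cf)
    qed
    then show ?thesis
      by (simp add: row_op_eq inner_vec_def) (rule sum.swap)
  qed
  obtain R where R: "set R = row ` C"
    using finite_list[OF finite_imageI[OF C(1)]] ..
  have mem_B: "w \<in> B \<longleftrightarrow> (\<forall>t. window L (\<lambda>s. w (t + s)) \<in> window L ` B)" for w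
  proof
    assume w: "w \<in> B"
    have "shift ` B \<subseteq> B"
      using B by (simp add: behavior_def)
    then have "(\<lambda>s. w (t + s)) \<in> B" for t
      using w by (rule shift_invariant_tail)
    then show "\<forall>t. window L (\<lambda>s. w (t + s)) \<in> window L ` B"
      by (simp add: imageI)
  next
    assume "\<forall>t. window L (\<lambda>s. w (t + s)) \<in> window L ` B"
    then show "w \<in> B"
      by (intro L) simp
  qed
  have mem_ker: "w \<in> ker R \<longleftrightarrow> (\<forall>t. window L (\<lambda>s. w (t + s)) \<in> window L ` B)" for w
  proof -
    have "w \<in> ker R \<longleftrightarrow> (\<forall>c\<in>C. \<forall>t. (\<Sum>s<L. c s \<bullet> w (t + s)) = 0)"
      by (simp add: ker_def R fun_eq_iff row)
    also have "\<dots> \<longleftrightarrow> (\<forall>t. \<forall>c\<in>C. (\<Sum>s<L. c s \<bullet> w (t + s)) = 0)"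
      by (rule iffI; simp)
    finally show ?thesis
      by (simp only: C(2))
  qed
  have "B = ker R"
    by (rule set_eqI) (simp only: mem_B mem_ker)
  then show ?thesis by (rule that)
qed

section \<open>Windows longer than the lag\<close>

text \<open>
  The lag is a least element of a set of degrees; existence of a kernel representation makes this
  set nonempty.
\<close>

lemma lag_attained:
  assumes "behavior B"
  obtains R where "B = ker R" and "max_row_degree R = lag B"
proof -
  obtain S where "B = ker S"
    using behavior_kernel_rep[OF assms] .
  then obtain R where "B = ker R" "\<And>S. B = ker S \<Longrightarrow> length R \<le> length S"
    using ex_has_least_nat[of "\<lambda>S. B = ker S" S length] by blast
  then have "\<exists>d R. minimal_kernel_rep R B \<and> max_row_degree R = d"
    by (auto simp: minimal_kernel_rep_def)
  then have "\<exists>R. minimal_kernel_rep R B \<and> max_row_degree R = lag B"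
    unfolding lag_def by (rule LeastI_ex)
  then show ?thesis
    using that by (auto simp: minimal_kernel_rep_def)
qed

text \<open>
  At time \<open>t\<close> a row of degree less than \<open>L\<close> sees no more than the window of length \<open>L\<close> that starts
  at \<open>t\<close>, and it cannot distinguish this window from an equal one in \<open>B\<close>.
\<close>

lemma subset_if_windows_subset:
  assumes B: "behavior B" and L: "lag B < L"
    and A: "shift ` A \<subseteq> A" and sub: "window L ` A \<subseteq> window L ` B"
  shows "A \<subseteq> B"
proof
  fix w assume w: "w \<in> A"
  obtain R where R: "B = ker R" "max_row_degree R = lag B"
    using lag_attained[OF B] .
  have "row_op r w t = 0" if r: "r \<in> set R" for r t
  proof -
    have "window L (\<lambda>s. w (t + s)) \<in> window L ` B"
      using shift_invariant_tail[OF A w] sub by blast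
    then obtain v where v: "v \<in> B" "\<forall>s<L. v s = w (t + s)"
      by (auto simp: window_mem_iff)
    have "degree (r $ j) < L" for j
    proof -
      have "degree (r $ j) \<le> row_degree r"
        by (simp add: row_degree_def)
      also have "\<dots> \<le> max_row_degree R"
        using r by (simp add: max_row_degree_def)
      finally show ?thesis using R(2) L by simp
    qed
    then have "v i = w (t + i)" if "i \<le> degree (r $ j)" for i j
      using v(2) that le_less_trans by blast
    then have "row_op r w t = row_op r v 0"
      unfolding row_op_eq by (intro sum.cong refl) simp
    also have "\<dots> = 0"
      using v(1) R(1) r by (simp add: ker_def)
    finally show ?thesis .
  qed
  then show "w \<in> B"
    using R(1) by (simp add: ker_def fun_eq_iff)
qed

section \<open>The implementability criterion\<close>

lemma linear_Inl_part: "linear (\<lambda>x :: real ^ ('q::finite + 'k::finite). \<chi> j. x $ Inl j)"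
  by (rule linearI) (simp_all add: vec_eq_iff)

lemma linear_Inr_part: "linear (\<lambda>x :: real ^ ('q::finite + 'k::finite). \<chi> j. x $ Inr j)"
  by (rule linearI) (simp_all add: vec_eq_iff)

lemma behavior_proj_w: "behavior P \<Longrightarrow> behavior (proj_w ` P)"
  unfolding proj_w_def[abs_def] by (rule behavior_image[OF _ linear_Inl_part])

lemma behavior_proj_c: "behavior P \<Longrightarrow> behavior (proj_c ` P)"
  unfolding proj_c_def[abs_def] by (rule behavior_image[OF _ linear_Inr_part])

lemma behavior_Int_vimage_proj_w:
  fixes P :: "(nat \<Rightarrow> real ^ ('q::finite + 'k::finite)) set"
  assumes P: "behavior P" and R: "behavior R"
  shows "behavior (P \<inter> proj_w -` R)"
proof -
  have "closed (P \<inter> proj_w -` R)"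
    using assms continuous_on_pointwise[OF linear_Inl_part]
    by (auto simp: behavior_def proj_w_def[abs_def] intro!: closed_Int closed_vimage)
  moreover have "proj_w (\<lambda>t. u t + v t) = (\<lambda>t. proj_w u t + proj_w v t)"
    "proj_w (\<lambda>t. a *\<^sub>R u t) = (\<lambda>t. a *\<^sub>R proj_w u t)"
    "proj_w (shift u) = shift (proj_w u)"
    "proj_w (\<lambda>t. 0 :: real ^ ('q + 'k)) = (\<lambda>t. 0)"
    for a and u v :: "nat \<Rightarrow> real ^ ('q + 'k)"
    by (simp_all add: proj_w_def shift_def fun_eq_iff vec_eq_iff)
  ultimately show ?thesis
    using assms by (simp add: behavior_def image_subset_iff)
qed

theorem theorem2:
  fixes P :: "(nat \<Rightarrow> real ^ ('q::finite + 'k::finite)) set"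
    and R :: "(nat \<Rightarrow> real ^ 'q) set"
    and L :: nat
  assumes "behavior P"
    and "behavior R"
    and "L > max (lag P) (max (lag R) (lag (proj_w ` P)))"
  shows "implementable P R \<longleftrightarrow>
    window L ` hidden_behavior P \<subseteq> window L ` R \<and>
    window L ` R \<subseteq> window L ` (proj_w ` P)"
proof
  assume "implementable P R"
  then obtain C where C: "behavior C" "proj_w ` interconnection P C = R"
    by (auto simp: implementable_def implements_def)
  have "(\<lambda>t. 0) \<in> C"
    using C(1) by (simp add: behavior_def)
  then have "hidden_behavior P \<subseteq> R"
    unfolding C(2)[symmetric] by (force simp: hidden_behavior_def interconnection_def)
  moreover have "R \<subseteq> proj_w ` P"
    unfolding C(2)[symmetric] by (auto simp: interconnection_def)
  ultimately show "window L ` hidden_behavior P \<subseteq> window L ` R \<and>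
    window L ` R \<subseteq> window L ` (proj_w ` P)"
    by (simp add: image_mono)
next
  assume sub: "window L ` hidden_behavior P \<subseteq> window L ` R \<and>
    window L ` R \<subseteq> window L ` (proj_w ` P)"
  have "shift ` hidden_behavior P \<subseteq> hidden_behavior P"
  proof -
    have "join (shift w) (\<lambda>t. 0 :: real ^ 'k) = shift (join w (\<lambda>t. 0))" for w :: "nat \<Rightarrow> real ^ 'q"
      by (simp add: join_def shift_def)
    then show ?thesis
      using assms(1) by (simp add: hidden_behavior_def behavior_def image_subset_iff)
  qed
  then have N: "hidden_behavior P \<subseteq> R"
    using subset_if_windows_subset assms(2,3) sub by (metis max_less_iff_conj)
  have RP: "R \<subseteq> proj_w ` P"
    using subset_if_windows_subset[OF behavior_proj_w[OF assms(1)], of L R] assms(2,3) sub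
    by (auto simp: behavior_def)
  define C where "C = proj_c ` (P \<inter> proj_w -` R)"
  have "behavior C"
    unfolding C_def using behavior_proj_c behavior_Int_vimage_proj_w assms(1,2) by blast
  moreover have "proj_w ` interconnection P C = R"
  proof
    show "R \<subseteq> proj_w ` interconnection P C"
    proof
      fix w assume w: "w \<in> R"
      then obtain x where "x \<in> P" "w = proj_w x"
        using RP by blast
      then show "w \<in> proj_w ` interconnection P C"
        using w by (auto simp: interconnection_def C_def
          intro!: image_eqI[of _ _ x] exI[of _ "proj_w x"] exI[of _ "proj_c x"])
    qed
    show "proj_w ` interconnection P C \<subseteq> R"
    proof
      fix w assume "w \<in> proj_w ` interconnection P C"
      then obtain x where x: "join w (proj_c x) \<in> P" "x \<in> P" "proj_w x \<in> R"
        by (auto simp: interconnection_def C_def)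
      have "join (\<lambda>t. w t - proj_w x t) (\<lambda>t. 0) = (\<lambda>t. join w (proj_c x) t - x t)"
        by (auto simp: join_def proj_w_def proj_c_def fun_eq_iff vec_eq_iff split: sum.split)
      then have "(\<lambda>t. w t - proj_w x t) \<in> R"
        using N behavior_diff[OF assms(1) x(1,2)] by (auto simp: hidden_behavior_def)
      then show "w \<in> R"
        using behavior_lincomb[OF assms(2) _ x(3), of "\<lambda>t. w t - proj_w x t" 1 1] by simp
    qed
  qed
  ultimately show "implementable P R"
    by (auto simp: implementable_def implements_def)
qed

end
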